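(* Let $G_1$ and $G_2$ be graphs on $n_1$ and $n_2$ vertices, respectively. For $j\in\{1,2\}$, let $I_j$ be the number of isolated vertices of $G_j$ if $n_j>1$, and $I_j=0$ if $n_j=1$. Let $G=G_1\vee G_2$. Then $$\mathcal{P}(G;x)=\left(1+\frac{I_1}{x}\right)\mathcal{P}(G_1;x)+\left(1+\frac{I_2}{x}\right)\mathcal{P}(G_2;x)+\big((x+1)^{n_1}-1\big)\big((x+1)^{n_2}-1\big).$$
   Context: Graphs are finite and simple with nonempty vertex set. The join $G_1\vee G_2$ is obtained from the disjoint union of $G_1$ and $G_2$ by adding all edges between a vertex of $G_1$ and a vertex of $G_2$. For $S\subseteq V(G)$, $S$ is a power dominating set if, after coloring $S$, coloring every neighbor of a vertex of $S$, and then repeatedly applying the forcing rule (a colored vertex with exactly one uncolored neighbor colors that neighbor) until no changes occur, all vertices are colored. $\mathcal{P}(G;x)=\sum_{i=1}^{n} p(G;i)x^i$, where $p(G;i)$ is the number of power dominating sets of size $i$ and $n$ is the order of $G$. *)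

theory Defs
  imports
    "Graph_Theory.Pair_Digraph"
    "HOL-Computational_Algebra.Polynomial_Factorial"
begin

text \<open>
  Finite simple graphs are rendered by the locale \<open>pair_graph\<close>: each edge \<open>{u, v}\<close> is the pair
  of arcs \<open>(u, v)\<close>, \<open>(v, u)\<close>, so the neighbours of \<open>u\<close> are \<open>parcs G `` {u}\<close>.
\<close>

definition graph_join ::
    "'a pair_pre_digraph \<Rightarrow> 'b pair_pre_digraph \<Rightarrow> ('a + 'b) pair_pre_digraph" where
  "graph_join G H =
     \<lparr> pverts = pverts G <+> pverts H,
       parcs = {(Inl u, Inl v) | u v. (u, v) \<in> parcs G}
             \<union> {(Inr u, Inr v) | u v. (u, v) \<in> parcs H}
             \<union> {(Inl u, Inr v) | u v. u \<in> pverts G \<and> v \<in> pverts H}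
             \<union> {(Inr v, Inl u) | u v. u \<in> pverts G \<and> v \<in> pverts H} \<rparr>"

definition isolated_verts :: "'a pair_pre_digraph \<Rightarrow> 'a set" where
  "isolated_verts G = {v \<in> pverts G. parcs G `` {v} = {}}"

definition dominated :: "'a pair_pre_digraph \<Rightarrow> 'a set \<Rightarrow> 'a set" where
  "dominated G S = S \<union> parcs G `` S"

text \<open>One round of the forcing rule, applied at all colored vertices simultaneously.\<close>

definition force_step :: "'a pair_pre_digraph \<Rightarrow> 'a set \<Rightarrow> 'a set" where
  "force_step G C = C \<union> {v. \<exists>u\<in>C. parcs G `` {u} - C = {v}}"

text \<open>
  The rounds increase, so on a finite graph the union below is the coloring
  at which the process becomes stationary.
\<close>

definition final_coloring :: "'a pair_pre_digraph \<Rightarrow> 'a set \<Rightarrow> 'a set" where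
  "final_coloring G S = (\<Union>k. (force_step G ^^ k) (dominated G S))"

definition power_dominating :: "'a pair_pre_digraph \<Rightarrow> 'a set \<Rightarrow> bool" where
  "power_dominating G S \<longleftrightarrow> S \<subseteq> pverts G \<and> final_coloring G S = pverts G"

definition num_power_dominating :: "'a pair_pre_digraph \<Rightarrow> nat \<Rightarrow> nat" where
  "num_power_dominating G i = card {S. power_dominating G S \<and> card S = i}"

definition power_dom_poly :: "'a pair_pre_digraph \<Rightarrow> int poly" where
  "power_dom_poly G = (\<Sum>i = 1..card (pverts G). monom (int (num_power_dominating G i)) i)"

lemma pair_graph_graph_join:
  assumes "pair_graph G" "pair_graph H"
  shows "pair_graph (graph_join G H)"
proof -
  interpret G: pair_graph G by fact
  interpret H: pair_graph H by fact
  let ?J = "graph_join G H"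
  have verts: "pverts ?J = pverts G <+> pverts H"
    by (simp add: graph_join_def)
  have sub: "parcs ?J \<subseteq> pverts ?J \<times> pverts ?J"
    by (auto simp: graph_join_def dest: G.in_arcsD1 G.in_arcsD2 H.in_arcsD1 H.in_arcsD2)
  have fin: "finite (pverts ?J)"
    by (simp add: verts G.pair_finite_verts H.pair_finite_verts)
  show ?thesis
  proof
    show "finite (parcs ?J)"
      using sub fin by (meson finite_SigmaI finite_subset)
    show "symmetric (with_proj ?J)"
      using G.pair_sym_arcs H.pair_sym_arcs
      by (auto simp: symmetric_def graph_join_def intro!: symI dest: symD)
    show "fst e \<noteq> snd e" if "e \<in> parcs ?J" for e
      using that by (auto simp: graph_join_def dest: G.no_loops' H.no_loops')
  qed (use sub fin in auto)
qed

end

theory Submission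
  imports Defs
begin

text \<open>
  A set meeting both sides of the join dominates it. A nonempty set \<open>S\<close> inside \<open>G\<^sub>1\<close> colors all of
  \<open>G\<^sub>2\<close> at once; the process then runs as in \<open>G\<^sub>1\<close>, except that a vertex of \<open>G\<^sub>2\<close> also forces the last
  uncolored vertex of \<open>G\<^sub>1\<close>. Hence \<open>S\<close> power dominates the join iff its final coloring in \<open>G\<^sub>1\<close> misses
  at most one vertex \<open>v\<close>. A single missed \<open>v\<close> has no colored neighbor, so it is isolated, and \<open>S\<close> is
  \<open>T - {v}\<close> for the power dominating set \<open>T = S \<union> {v}\<close> of \<open>G\<^sub>1\<close>. As every power dominating set contains
  all isolated vertices, these sets contribute \<open>I\<^sub>1 / x\<close> times the polynomial of \<open>G\<^sub>1\<close>; the case of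
  one vertex is special because there \<open>T - {v}\<close> is empty.
\<close>

section \<open>The final coloring as a least closed set\<close>

text \<open>These are the colorings at which the forcing process is stationary. The final coloring
  turns out to be the least one containing \<open>dominated G S\<close>, which spares later
  arguments any induction on rounds.\<close>

definition forcing_closed :: "'a pair_pre_digraph \<Rightarrow> 'a set \<Rightarrow> bool" where
  "forcing_closed G C \<longleftrightarrow> (\<forall>u\<in>C. \<forall>v. parcs G `` {u} - C \<noteq> {v})"

text \<open>Forcing is monotone: if \<open>u\<close> forces \<open>v\<close> from a coloring inside
  \<open>C\<close> and \<open>v\<close> lay outside \<open>C\<close>, then \<open>v\<close> would
  also be the only neighbor of \<open>u\<close> outside \<open>C\<close>, against
  closedness.\<close>

lemma final_coloring_least:
  assumes "dominated G S \<subseteq> C" and "forcing_closed G C"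
  shows "final_coloring G S \<subseteq> C"
proof -
  have step: "force_step G A \<subseteq> C" if "A \<subseteq> C" for A
  proof
    fix v assume "v \<in> force_step G A"
    then consider "v \<in> A" | u where "u \<in> A" "parcs G `` {u} - A = {v}"
      unfolding force_step_def by blast
    then show "v \<in> C"
    proof cases
      case 2
      show ?thesis
      proof (rule ccontr)
        assume "v \<notin> C"
        with 2 \<open>A \<subseteq> C\<close> have "parcs G `` {u} - C = {v}" by blast
        with 2 \<open>A \<subseteq> C\<close> assms(2) show False by (auto simp: forcing_closed_def)
      qed
    qed (use that in blast)
  qed
  have "(force_step G ^^ k) (dominated G S) \<subseteq> C" for k
    by (induction k) (use assms(1) step in auto)
  then show ?thesis
    unfolding final_coloring_def by blast
qed

lemma dominated_subset_final_coloring: "dominated G S \<subseteq> final_coloring G S"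
proof -
  have "(force_step G ^^ 0) (dominated G S) \<subseteq> final_coloring G S"
    unfolding final_coloring_def by (rule UN_upper) simp
  then show ?thesis by simp
qed

lemma subset_final_coloring: "S \<subseteq> final_coloring G S"
  using dominated_subset_final_coloring[of G S] by (auto simp: dominated_def)

text \<open>A compactness argument, used to find one round by which finitely many vertices are all
  colored.\<close>

lemma finite_subset_mono_UN:
  fixes C :: "nat \<Rightarrow> 'a set"
  assumes "finite A" and "\<And>k l. k \<le> l \<Longrightarrow> C k \<subseteq> C l" and "A \<subseteq> (\<Union>k. C k)"
  shows "\<exists>k. A \<subseteq> C k"
  using assms(1,3)
proof (induction A rule: finite_induct)
  case (insert a A)
  then obtain k l where "A \<subseteq> C k" "a \<in> C l" by auto
  then have "insert a A \<subseteq> C (max k l)"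
    using assms(2)[of k "max k l"] assms(2)[of l "max k l"] by auto
  then show ?case ..
qed simp

text \<open>If \<open>v\<close> were the only uncolored neighbor of \<open>u\<close>, then by
  finiteness \<open>u\<close> and all its other neighbors would be colored by a common round
  \<open>k\<close>, so round \<open>k + 1\<close> would color \<open>v\<close>.\<close>

lemma forcing_closed_final_coloring:
  assumes "finite (parcs G)"
  shows "forcing_closed G (final_coloring G S)"
  unfolding forcing_closed_def
proof (intro ballI allI notI)
  let ?C = "\<lambda>k. (force_step G ^^ k) (dominated G S)"
  fix u v assume u: "u \<in> final_coloring G S"
    and v: "parcs G `` {u} - final_coloring G S = {v}"
  have mono: "?C k \<subseteq> ?C l" if "k \<le> l" for k l
    using that by (rule lift_Suc_mono_le[rotated]) (auto simp: force_step_def)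
  have fin: "finite (insert u (parcs G `` {u} - {v}))"
    using assms by (simp add: finite_Image)
  have "insert u (parcs G `` {u} - {v}) \<subseteq> (\<Union>k. ?C k)"
    using u v unfolding final_coloring_def by blast
  then have "\<exists>k. insert u (parcs G `` {u} - {v}) \<subseteq> ?C k"
    by (rule finite_subset_mono_UN[OF fin mono, rotated])
  then obtain k where k: "insert u (parcs G `` {u} - {v}) \<subseteq> ?C k" ..
  have "v \<notin> ?C k"
    using v unfolding final_coloring_def by blast
  with k v have "parcs G `` {u} - ?C k = {v}" by blast
  with k have "v \<in> ?C (Suc k)"
    by (auto simp: force_step_def)
  then have "v \<in> final_coloring G S"
    unfolding final_coloring_def by blast
  with v show False by blast
qed

lemma dominated_subset_verts:
  assumes "pair_graph G" and "S \<subseteq> pverts G"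
  shows "dominated G S \<subseteq> pverts G"
proof -
  interpret pair_graph G by fact
  show ?thesis
    using assms(2) by (auto simp: dominated_def dest: in_arcsD2)
qed

lemma forcing_closed_verts:
  assumes "pair_graph G"
  shows "forcing_closed G (pverts G)"
proof -
  interpret pair_graph G by fact
  show ?thesis
    by (auto simp: forcing_closed_def dest!: equalityD2 dest: in_arcsD2)
qed

lemma final_coloring_subset_verts:
  assumes "pair_graph G" and "S \<subseteq> pverts G"
  shows "final_coloring G S \<subseteq> pverts G"
  by (rule final_coloring_least[OF dominated_subset_verts forcing_closed_verts]) fact+

lemma final_coloring_empty: "final_coloring G {} = {}"
  using final_coloring_least[of G "{}" "{}"] by (simp add: dominated_def forcing_closed_def)

section \<open>Weighted sums over power dominating and almost power dominating sets\<close>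

definition power_dominating_sets :: "'a pair_pre_digraph \<Rightarrow> 'a set set" where
  "power_dominating_sets G = {S. power_dominating G S}"

text \<open>These are the traces of the power dominating sets of a join that stay on one side. The
  vertex \<open>v\<close> may itself be colored, so no vertex at all need be missed. The empty set
  is excluded since in a one-vertex graph it too misses just one vertex.\<close>

definition almost_power_dominating_sets :: "'a pair_pre_digraph \<Rightarrow> 'a set set" where
  "almost_power_dominating_sets G =
     {S. S \<noteq> {} \<and> S \<subseteq> pverts G \<and> (\<exists>v. pverts G \<subseteq> insert v (final_coloring G S))}"

lemma finite_power_dominating_sets:
  assumes "pair_graph G"
  shows "finite (power_dominating_sets G)"
proof -
  interpret pair_graph G by fact
  show ?thesis
    by (rule finite_subset[of _ "Pow (pverts G)"])
      (auto simp: power_dominating_sets_def power_dominating_def pair_finite_verts)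
qed

text \<open>Grouping sets by size gives a form of the polynomial in which decompositions and
  bijections of set families can be used directly.\<close>

lemma power_dom_poly_altdef:
  assumes "pair_graph G" and "pverts G \<noteq> {}"
  shows "power_dom_poly G = (\<Sum>S\<in>power_dominating_sets G. [:0, 1:] ^ card S)"
proof -
  interpret pair_graph G by fact
  let ?P = "power_dominating_sets G"
  have card: "card ` ?P \<subseteq> {1..card (pverts G)}"
  proof safe
    fix S assume "S \<in> ?P"
    then have S: "S \<subseteq> pverts G" "final_coloring G S = pverts G"
      by (auto simp: power_dominating_sets_def power_dominating_def)
    \<comment> \<open>The defining sum starts at size 1, so the empty set has to be ruled
      out.\<close>
    with assms(2) have "S \<noteq> {}" by (auto simp: final_coloring_empty)
    with S show "card S \<in> {1..card (pverts G)}"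
      by (auto simp: card_mono Suc_le_eq card_gt_0_iff intro: finite_subset pair_finite_verts)
  qed
  have "(\<Sum>S\<in>?P. [:0, 1::int:] ^ card S) =
        (\<Sum>i = 1..card (pverts G). \<Sum>S\<in>{S \<in> ?P. card S = i}. [:0, 1:] ^ card S)"
    by (rule sum.group[OF finite_power_dominating_sets[OF assms(1)] _ card, symmetric]) simp
  also have "\<dots> = power_dom_poly G"
    unfolding power_dom_poly_def
    by (intro sum.cong refl)
      (simp add: num_power_dominating_def power_dominating_sets_def monom_altdef of_nat_poly)
  finally show ?thesis ..
qed

lemma to_fract_power_dom_poly:
  assumes "pair_graph G" and "pverts G \<noteq> {}"
  shows "to_fract (power_dom_poly G) = (\<Sum>S\<in>power_dominating_sets G. to_fract [:0, 1:] ^ card S)"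
proof -
  have pow: "to_fract (p ^ k) = to_fract p ^ k" for p :: "int poly" and k
    by (induction k) auto
  have "to_fract (\<Sum>S\<in>A. f S) = (\<Sum>S\<in>A. to_fract (f S))"
    for A :: "'a set set" and f :: "'a set \<Rightarrow> int poly"
    by (induction A rule: infinite_finite_induct) auto
  then show ?thesis
    by (simp only: power_dom_poly_altdef[OF assms] pow)
qed

text \<open>Any neighbor of \<open>v\<close> would be colored and have \<open>v\<close> as its only
  uncolored neighbor, hence would force \<open>v\<close>.\<close>

lemma sole_uncolored_imp_isolated:
  assumes "pair_graph G" and "S \<subseteq> pverts G" "v \<in> pverts G"
    and "v \<notin> final_coloring G S" and "pverts G \<subseteq> insert v (final_coloring G S)"
  shows "v \<in> isolated_verts G"
proof -
  interpret pair_graph G by fact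
  have "(v, u) \<notin> parcs G" for u
  proof
    assume vu: "(v, u) \<in> parcs G"
    then have uv: "(u, v) \<in> parcs G"
      using arcs_symmetric by simp
    have "u \<in> pverts G" "u \<noteq> v"
      using vu no_loops[OF vu] by (auto dest: in_arcsD2)
    then have "u \<in> final_coloring G S" using assms by blast
    moreover have "parcs G `` {u} - final_coloring G S = {v}"
      using uv assms by (auto dest: in_arcsD2)
    ultimately show False
      using forcing_closed_final_coloring[OF pair_finite_arcs] by (auto simp: forcing_closed_def)
  qed
  with assms show ?thesis by (auto simp: isolated_verts_def)
qed

lemma isolated_verts_no_arcs:
  assumes "pair_graph G" and "v \<in> isolated_verts G"
  shows "(u, v) \<notin> parcs G" "(v, u) \<notin> parcs G"
proof -
  interpret pair_graph G by fact
  show "(v, u) \<notin> parcs G"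
    using assms(2) by (auto simp: isolated_verts_def)
  then show "(u, v) \<notin> parcs G"
    using arcs_symmetric by auto
qed

text \<open>An isolated vertex is nobody's neighbor, so coloring it changes no set of uncolored
  neighbors and preserves closedness.\<close>

lemma final_coloring_insert_isolated:
  assumes "pair_graph G" and v: "v \<in> isolated_verts G"
  shows "final_coloring G (insert v S) = insert v (final_coloring G S)"
proof
  interpret pair_graph G by fact
  note arcs = isolated_verts_no_arcs[OF assms]
  note closed = forcing_closed_final_coloring[OF pair_finite_arcs]
  show "final_coloring G (insert v S) \<subseteq> insert v (final_coloring G S)"
  proof (rule final_coloring_least)
    show "dominated G (insert v S) \<subseteq> insert v (final_coloring G S)"
      using dominated_subset_final_coloring[of G S] arcs by (auto simp: dominated_def)
    have "parcs G `` {u} - insert v (final_coloring G S) = parcs G `` {u} - final_coloring G S" for u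
      using arcs by auto
    then show "forcing_closed G (insert v (final_coloring G S))"
      using closed[of S] arcs by (auto simp: forcing_closed_def)
  qed
  have "final_coloring G S \<subseteq> final_coloring G (insert v S)"
    by (rule final_coloring_least[OF _ closed])
      (use dominated_subset_final_coloring[of G "insert v S"] in \<open>auto simp: dominated_def\<close>)
  then show "insert v (final_coloring G S) \<subseteq> final_coloring G (insert v S)"
    using subset_final_coloring[of "insert v S" G] by auto
qed

text \<open>Since no arc ends in \<open>v\<close>, the complement of \<open>v\<close> is closed and
  contains \<open>dominated G S\<close>.\<close>

lemma isolated_notin_final_coloring:
  assumes "pair_graph G" and "v \<in> isolated_verts G" and "v \<notin> S"
  shows "v \<notin> final_coloring G S"
proof -
  have "final_coloring G S \<subseteq> - {v}"
    by (rule final_coloring_least)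
      (use assms(3) isolated_verts_no_arcs[OF assms(1,2)] in
        \<open>auto simp: dominated_def forcing_closed_def\<close>)
  then show ?thesis by blast
qed

lemma almost_power_dominating_sets_decomp:
  assumes "pair_graph G" and "card (pverts G) > 1"
  shows "almost_power_dominating_sets G = power_dominating_sets G \<union>
    (\<lambda>(v, T). T - {v}) ` (isolated_verts G \<times> power_dominating_sets G)" (is "?L = ?P \<union> ?R")
proof (intro equalityI subsetI)
  fix S assume "S \<in> ?L"
  then obtain v where S: "S \<noteq> {}" "S \<subseteq> pverts G" "pverts G \<subseteq> insert v (final_coloring G S)"
    by (auto simp: almost_power_dominating_sets_def)
  note sub = final_coloring_subset_verts[OF assms(1) S(2)]
  show "S \<in> ?P \<union> ?R"
  proof (cases "pverts G \<subseteq> final_coloring G S")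
    case True
    with S sub show ?thesis by (auto simp: power_dominating_sets_def power_dominating_def)
  next
    case False
    with S have v: "v \<in> pverts G" "v \<notin> final_coloring G S" by auto
    then have iso: "v \<in> isolated_verts G"
      using sole_uncolored_imp_isolated assms(1) S by metis
    have "v \<notin> S" using v subset_final_coloring[of S G] by blast
    moreover have "insert v S \<in> ?P"
      using S v sub final_coloring_insert_isolated[OF assms(1) iso, of S]
      by (auto simp: power_dominating_sets_def power_dominating_def)
    ultimately have "S = (\<lambda>(v, T). T - {v}) (v, insert v S)" by auto
    with iso \<open>insert v S \<in> ?P\<close> show ?thesis by blast
  qed
next
  fix S assume "S \<in> ?P \<union> ?R"
  then show "S \<in> ?L"
  proof
    assume "S \<in> ?P"
    with assms(2) show ?thesis
      using final_coloring_empty[of G]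
      by (auto simp: power_dominating_sets_def power_dominating_def almost_power_dominating_sets_def)
  next
    assume "S \<in> ?R"
    then obtain v T where *: "S = T - {v}" "v \<in> isolated_verts G"
      "T \<subseteq> pverts G" "final_coloring G T = pverts G"
      by (auto simp: power_dominating_sets_def power_dominating_def)
    have "v \<in> T"
      using * isolated_notin_final_coloring[OF assms(1) *(2)] by (auto simp: isolated_verts_def)
    then have verts: "pverts G = insert v (final_coloring G S)"
      using * final_coloring_insert_isolated[OF assms(1) *(2), of S] by (simp add: insert_absorb)
    \<comment> \<open>An empty \<open>S\<close> would color nothing and leave \<open>v\<close> as
      the only vertex, against the order being at least two.\<close>
    then have "S \<noteq> {}"
      using assms(2) by (auto simp: final_coloring_empty)
    with verts * show ?thesis by (auto simp: almost_power_dominating_sets_def)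
  qed
qed

lemma power_dominating_sets_isolated:
  assumes "pair_graph G" and "v \<in> isolated_verts G" and "T \<in> power_dominating_sets G"
  shows "v \<in> T"
  using assms isolated_notin_final_coloring[OF assms(1,2), of T]
  by (auto simp: power_dominating_sets_def power_dominating_def isolated_verts_def)

text \<open>The denominator \<open>x\<close> is cleared, so the identity holds in every commutative
  semiring.\<close>

lemma sum_almost_power_dominating_sets:
  fixes x :: "'b :: comm_semiring_1"
  assumes "pair_graph G" and "pverts G \<noteq> {}"
  defines "I \<equiv> if card (pverts G) > 1 then card (isolated_verts G) else 0"
  shows "x * (\<Sum>S\<in>almost_power_dominating_sets G. x ^ card S) =
    (x + of_nat I) * (\<Sum>S\<in>power_dominating_sets G. x ^ card S)"
proof -
  interpret pair_graph G by fact
  let ?P = "power_dominating_sets G"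
  note fin = finite_power_dominating_sets[OF assms(1)]
  show ?thesis
  proof (cases "card (pverts G) > 1")
    case True
    let ?f = "\<lambda>(v, T). T - {v}"
    let ?D = "isolated_verts G \<times> ?P"
    note mem = power_dominating_sets_isolated[OF assms(1)]
    have finI: "finite (isolated_verts G)"
      by (simp add: isolated_verts_def pair_finite_verts)
    \<comment> \<open>Each set in the second family lacks an isolated vertex, which every power
      dominating set contains.\<close>
    have disj: "?P \<inter> ?f ` ?D = {}"
      using mem by fastforce
    \<comment> \<open>\<open>T\<close> contains all isolated vertices, so \<open>v\<close> is
      recovered as the only isolated vertex missing from \<open>T - {v}\<close>.\<close>
    have inj: "inj_on ?f ?D"
    proof (rule inj_onI, clarify)
      fix v T v' T'
      assume *: "v \<in> isolated_verts G" "T \<in> ?P" "v' \<in> isolated_verts G" "T' \<in> ?P"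
        "T - {v} = T' - {v'}"
      with mem have "v \<in> T" "v \<in> T'" "v' \<in> T" "v' \<in> T'" by blast+
      with *(5) show "v = v' \<and> T = T'" by blast
    qed
    \<comment> \<open>The factor \<open>x\<close> makes up for the deleted vertex.\<close>
    have "x * (\<Sum>S\<in>?f ` ?D. x ^ card S) = (\<Sum>p\<in>?D. x * x ^ card (?f p))"
      by (simp add: sum.reindex[OF inj] sum_distrib_left o_def)
    also have "\<dots> = (\<Sum>(v, T)\<in>?D. x ^ card T)"
    proof (intro sum.cong refl, clarify)
      fix v T assume vT: "v \<in> isolated_verts G" "T \<in> ?P"
      have "finite T"
        using vT pair_finite_verts
        by (auto simp: power_dominating_sets_def power_dominating_def intro: finite_subset)
      then have "Suc (card (T - {v})) = card T"
        using mem[OF vT] by (rule card_Suc_Diff1)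
      then show "x * x ^ card (T - {v}) = x ^ card T"
        by (metis power_Suc)
    qed
    also have "\<dots> = of_nat (card (isolated_verts G)) * (\<Sum>T\<in>?P. x ^ card T)"
      by (simp add: sum.cartesian_product[symmetric])
    finally have R: "x * (\<Sum>S\<in>?f ` ?D. x ^ card S) =
      of_nat (card (isolated_verts G)) * (\<Sum>T\<in>?P. x ^ card T)" .
    show ?thesis
      unfolding almost_power_dominating_sets_decomp[OF assms(1) True]
      using True fin finI disj R
      by (simp add: sum.union_disjoint I_def distrib_left distrib_right)
  next
    case False
    with assms(2) have "card (pverts G) = 1"
      by (metis One_nat_def card_eq_0_iff less_one linorder_neqE_nat pair_finite_verts)
    then obtain w where w: "pverts G = {w}" by (auto simp: card_1_singleton_iff)
    \<comment> \<open>The lone vertex \<open>w\<close> is isolated, but deleting it leaves the empty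
      set. Hence nothing is gained and \<open>I\<close> is 0.\<close>
    have "almost_power_dominating_sets G = ?P"
    proof -
      have "final_coloring G {w} = {w}"
        using final_coloring_subset_verts[OF assms(1), of "{w}"] subset_final_coloring[of "{w}" G] w
        by auto
      then show ?thesis
        using w final_coloring_empty[of G]
        by (auto simp: almost_power_dominating_sets_def power_dominating_sets_def
            power_dominating_def subset_singleton_iff)
    qed
    with False show ?thesis by (simp add: I_def)
  qed
qed

section \<open>One side of a join inside the whole\<close>

text \<open>Abstracting the embedding \<open>f\<close> and the opposite side \<open>W\<close> lets
  one proof serve both sides. Once \<open>W\<close> is colored, \<open>f u\<close> has as uncolored
  neighbors just the images of those of \<open>u\<close>, while a vertex of \<open>W\<close> is
  adjacent to the whole image of \<open>G\<close> and can force only its last uncolored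
  vertex.\<close>

lemma power_dominating_embedded_iff:
  fixes f :: "'a \<Rightarrow> 'b"
  assumes "pair_graph G" and "pair_graph J" and "inj f"
    and verts: "pverts J = f ` pverts G \<union> W" and disj: "f ` pverts G \<inter> W = {}" and "W \<noteq> {}"
    and arcs: "\<And>u. u \<in> pverts G \<Longrightarrow> parcs J `` {f u} = f ` (parcs G `` {u}) \<union> W"
    and arcs': "\<And>w. w \<in> W \<Longrightarrow> f ` pverts G \<subseteq> parcs J `` {w}"
    and A: "A \<subseteq> pverts G" "A \<noteq> {}"
  shows "power_dominating J (f ` A) \<longleftrightarrow> A \<in> almost_power_dominating_sets G"
proof -
  interpret G: pair_graph G by fact
  interpret J: pair_graph J by fact
  let ?F = "final_coloring G A" and ?FJ = "final_coloring J (f ` A)"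
  note sub = final_coloring_subset_verts[OF assms(1) A(1)]
  have fA: "f ` A \<subseteq> pverts J" using verts A by auto
  note subJ = final_coloring_subset_verts[OF assms(2) fA]
  note closedJ = forcing_closed_final_coloring[OF J.pair_finite_arcs, of "f ` A"]
  have dom: "dominated J (f ` A) = f ` dominated G A \<union> W"
  proof -
    have "parcs J `` (f ` A) = (\<Union>u\<in>A. parcs J `` {f u})" by blast
    also have "\<dots> = (\<Union>u\<in>A. f ` (parcs G `` {u}) \<union> W)"
      using arcs A by (intro SUP_cong) auto
    also have "\<dots> = f ` (parcs G `` A) \<union> W" using A by blast
    finally show ?thesis by (auto simp: dominated_def)
  qed
  then have W: "W \<subseteq> ?FJ"
    using dominated_subset_final_coloring[of J "f ` A"] by auto
  have F: "f ` ?F \<subseteq> ?FJ"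
  proof -
    \<comment> \<open>The preimage of the coloring of \<open>J\<close> is closed in
      \<open>G\<close>, because the colored set \<open>W\<close> adds no uncolored
      neighbors.\<close>
    have "?F \<subseteq> {u \<in> pverts G. f u \<in> ?FJ}"
    proof (rule final_coloring_least)
      show "dominated G A \<subseteq> {u \<in> pverts G. f u \<in> ?FJ}"
        using dom dominated_subset_final_coloring[of J "f ` A"]
          dominated_subset_verts[OF assms(1) A(1)] by blast
      have "parcs J `` {f u} - ?FJ = f ` (parcs G `` {u} - {u \<in> pverts G. f u \<in> ?FJ})"
        if "u \<in> pverts G" for u
        using arcs[OF that] W by (auto dest: G.in_arcsD2)
      then show "forcing_closed G {u \<in> pverts G. f u \<in> ?FJ}"
        using closedJ by (auto simp: forcing_closed_def)
    qed
    then show ?thesis by blast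
  qed
  have "?FJ = pverts J \<longleftrightarrow> (\<exists>v. pverts G \<subseteq> insert v ?F)"
  proof
    assume all: "?FJ = pverts J"
    show "\<exists>v. pverts G \<subseteq> insert v ?F"
    proof (rule ccontr)
      assume none: "\<nexists>v. pverts G \<subseteq> insert v ?F"
      \<comment> \<open>At least two vertices of \<open>G\<close> stay uncolored, which makes the
        image of \<open>?F\<close> together with \<open>W\<close> closed in
        \<open>J\<close>.\<close>
      have "?FJ \<subseteq> f ` ?F \<union> W"
      proof (rule final_coloring_least)
        show "dominated J (f ` A) \<subseteq> f ` ?F \<union> W"
          using dom dominated_subset_final_coloring[of G A] by blast
        show "forcing_closed J (f ` ?F \<union> W)"
          unfolding forcing_closed_def
        proof (intro ballI allI notI)
          fix y z assume y: "y \<in> f ` ?F \<union> W" and z: "parcs J `` {y} - (f ` ?F \<union> W) = {z}"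
          from y show False
          proof
            assume "y \<in> f ` ?F"
            then obtain u where u: "u \<in> ?F" "y = f u" by blast
            have "parcs J `` {y} - (f ` ?F \<union> W) = f ` (parcs G `` {u} - ?F)"
            proof -
              have "f ` (parcs G `` {u}) \<inter> W = {}"
                using disj by (auto dest: G.in_arcsD2)
              then show ?thesis
                using arcs[of u] u sub by (simp add: subset_iff image_set_diff[OF \<open>inj f\<close>]) blast
            qed
            with z have "f ` (parcs G `` {u} - ?F) = {z}" by simp
            then obtain v where "parcs G `` {u} - ?F = {v}"
              using \<open>inj f\<close> by (metis (no_types, lifting) image_is_empty insert_not_empty
                  inj_image_eq_iff image_insert image_empty imageE singletonI)
            with u show False
              using forcing_closed_final_coloring[OF G.pair_finite_arcs, of A]
              by (auto simp: forcing_closed_def)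
          next
            assume "y \<in> W"
            \<comment> \<open>Two uncolored neighbors of \<open>y\<close> prevent it from
              forcing.\<close>
            obtain v where v: "v \<in> pverts G" "v \<notin> ?F" using none by blast
            obtain v' where v': "v' \<in> pverts G" "v' \<notin> ?F" "v' \<noteq> v" using none by blast
            have "f v \<in> parcs J `` {y} - (f ` ?F \<union> W)" "f v' \<in> parcs J `` {y} - (f ` ?F \<union> W)"
              using v v' arcs'[OF \<open>y \<in> W\<close>] disj \<open>inj f\<close> by (auto dest: injD)
            with z have "f v = f v'" by auto
            with v' \<open>inj f\<close> show False by (auto dest: injD)
          qed
        qed
      qed
      moreover obtain v where v: "v \<in> pverts G" "v \<notin> ?F" using none by blast
      moreover have "f v \<notin> f ` ?F \<union> W"
        using v disj \<open>inj f\<close> by (auto dest: injD)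
      ultimately show False
        using all verts by blast
    qed
  next
    assume "\<exists>v. pverts G \<subseteq> insert v ?F"
    then obtain v where v: "pverts G \<subseteq> insert v ?F" by blast
    \<comment> \<open>Only the image of \<open>v\<close> could still be uncolored, and then any
      vertex of \<open>W\<close> would force it.\<close>
    have "f u \<in> ?FJ" if u: "u \<in> pverts G" for u
    proof (rule ccontr)
      assume nu: "f u \<notin> ?FJ"
      with F u v have "u = v" by blast
      obtain w where w: "w \<in> W" using \<open>W \<noteq> {}\<close> by blast
      have "parcs J `` {w} - ?FJ = {f u}"
      proof
        show "{f u} \<subseteq> parcs J `` {w} - ?FJ" using nu u arcs'[OF w] by blast
        have "parcs J `` {w} \<subseteq> f ` pverts G \<union> W"
          using verts by (auto dest: J.in_arcsD2)
        then show "parcs J `` {w} - ?FJ \<subseteq> {f u}"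
          using F W v \<open>u = v\<close> by blast
      qed
      with w W closedJ show False by (auto simp: forcing_closed_def)
    qed
    then have "f ` pverts G \<union> W \<subseteq> ?FJ" using W by auto
    with verts subJ show "?FJ = pverts J" by simp
  qed
  with A fA show ?thesis
    by (simp add: power_dominating_def almost_power_dominating_sets_def)
qed

section \<open>Subset sums and the power dominating sets of the join\<close>

text \<open>Each element is either left out, with weight 1, or chosen, with weight
  \<open>x\<close>.\<close>

lemma sum_Pow_power_card:
  fixes x :: "'b :: comm_semiring_1"
  assumes "finite A"
  shows "(\<Sum>S\<in>Pow A. x ^ card S) = (x + 1) ^ card A"
  using assms
proof (induction A rule: finite_induct)
  case (insert a A)
  have fin: "finite S" if "S \<in> Pow A" for S
    using that insert.hyps(1) by (auto intro: finite_subset)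
  have "(\<Sum>S\<in>Pow (insert a A). x ^ card S) =
        (\<Sum>S\<in>Pow A. x ^ card S) + (\<Sum>S\<in>insert a ` Pow A. x ^ card S)"
    unfolding Pow_insert using insert.hyps by (intro sum.union_disjoint) auto
  also have "(\<Sum>S\<in>insert a ` Pow A. x ^ card S) = (\<Sum>S\<in>Pow A. x * x ^ card S)"
  proof -
    have "inj_on (insert a) (Pow A)"
      using insert.hyps(2) by (intro inj_on_inverseI[where g = "\<lambda>S. S - {a}"]) auto
    moreover have "x ^ card (insert a S) = x * x ^ card S" if "S \<in> Pow A" for S
      using fin[OF that] that insert.hyps(2) by (subst card_insert_disjoint) auto
    ultimately show ?thesis by (simp add: sum.reindex)
  qed
  finally show ?case
    using insert by (simp add: sum_distrib_left[symmetric] algebra_simps)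
qed simp

text \<open>Every vertex is adjacent to the chosen vertices of the opposite side, so the domination
  step alone colors everything.\<close>

lemma power_dominating_join_mixed:
  assumes "pair_graph G" and "pair_graph H"
    and "A \<subseteq> pverts G" "A \<noteq> {}" and "B \<subseteq> pverts H" "B \<noteq> {}"
  shows "power_dominating (graph_join G H) (A <+> B)"
proof -
  let ?J = "graph_join G H"
  have sub: "A <+> B \<subseteq> pverts ?J"
    using assms by (auto simp: graph_join_def)
  have "pverts ?J \<subseteq> dominated ?J (A <+> B)"
    using assms(3-) by (fastforce simp: graph_join_def dominated_def)
  with sub show ?thesis
    using dominated_subset_final_coloring[of ?J "A <+> B"]
      final_coloring_subset_verts[OF pair_graph_graph_join[OF assms(1,2)] sub]
    by (auto simp: power_dominating_def)
qed

text \<open>The three families are the sets meeting only the left side, only the right side, and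
  both sides.\<close>

lemma power_dominating_sets_join:
  assumes "pair_graph G" "pverts G \<noteq> {}" and "pair_graph H" "pverts H \<noteq> {}"
  shows "power_dominating_sets (graph_join G H) =
    (`) Inl ` almost_power_dominating_sets G \<union> (`) Inr ` almost_power_dominating_sets H \<union>
    (\<lambda>(A, B). A <+> B) ` ((Pow (pverts G) - {{}}) \<times> (Pow (pverts H) - {{}}))"
    (is "?P = ?L \<union> ?R \<union> ?M")
proof -
  let ?J = "graph_join G H"
  interpret G: pair_graph G by fact
  interpret H: pair_graph H by fact
  note J = pair_graph_graph_join[OF assms(1,3)]
  have Inl: "power_dominating ?J (Inl ` A) \<longleftrightarrow> A \<in> almost_power_dominating_sets G"
    if "A \<subseteq> pverts G" "A \<noteq> {}" for A
    by (rule power_dominating_embedded_iff[OF assms(1) J, where W = "Inr ` pverts H"])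
      (use assms that in \<open>auto simp: graph_join_def\<close>)
  have Inr: "power_dominating ?J (Inr ` B) \<longleftrightarrow> B \<in> almost_power_dominating_sets H"
    if "B \<subseteq> pverts H" "B \<noteq> {}" for B
    by (rule power_dominating_embedded_iff[OF assms(3) J, where W = "Inl ` pverts G"])
      (use assms that in \<open>auto simp: graph_join_def\<close>)
  show ?thesis
  proof (intro equalityI subsetI)
    fix S assume "S \<in> ?P"
    then have S: "power_dominating ?J S" by (simp add: power_dominating_sets_def)
    define A B where "A = Inl -` S" and "B = Inr -` S"
    have SAB: "S = A <+> B"
    proof (rule set_eqI)
      show "z \<in> S \<longleftrightarrow> z \<in> A <+> B" for z
        by (cases z) (auto simp: A_def B_def)
    qed
    have AB: "A \<subseteq> pverts G" "B \<subseteq> pverts H"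
      using S unfolding SAB by (auto simp: power_dominating_def graph_join_def)
    \<comment> \<open>The empty set colors nothing, so \<open>S\<close> meets at least one
      side.\<close>
    have "S \<noteq> {}"
      using S assms by (auto simp: power_dominating_def final_coloring_empty graph_join_def)
    then consider "A \<noteq> {}" "B \<noteq> {}" | "A \<noteq> {}" "S = Inl ` A" | "B \<noteq> {}" "S = Inr ` B"
      unfolding SAB by (cases "A = {}"; cases "B = {}") (auto simp: Plus_def)
    then show "S \<in> ?L \<union> ?R \<union> ?M"
    proof cases
      case 1
      with SAB AB show ?thesis by auto
    next
      case 2
      with S Inl AB show ?thesis by auto
    next
      case 3
      with S Inr AB show ?thesis by auto
    qed
  next
    fix S assume "S \<in> ?L \<union> ?R \<union> ?M"
    then show "S \<in> ?P"
    proof (elim UnE)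
      assume "S \<in> ?L"
      with Inl show ?thesis
        by (auto simp: power_dominating_sets_def almost_power_dominating_sets_def)
    next
      assume "S \<in> ?R"
      with Inr show ?thesis
        by (auto simp: power_dominating_sets_def almost_power_dominating_sets_def)
    next
      assume "S \<in> ?M"
      then obtain p where "p \<in> (Pow (pverts G) - {{}}) \<times> (Pow (pverts H) - {{}})"
        "S = (\<lambda>(A, B). A <+> B) p" by (rule imageE)
      then show ?thesis
        using power_dominating_join_mixed[OF assms(1,3), of "fst p" "snd p"]
        by (simp add: power_dominating_sets_def mem_Times_iff case_prod_beta)
    qed
  qed
qed

lemma sum_power_dominating_sets_join:
  fixes G :: "'a pair_pre_digraph" and H :: "'b pair_pre_digraph" and x :: "'c :: comm_ring_1"
  assumes "pair_graph G" "pverts G \<noteq> {}" and "pair_graph H" "pverts H \<noteq> {}"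
  shows "(\<Sum>S\<in>power_dominating_sets (graph_join G H). x ^ card S) =
    (\<Sum>S\<in>almost_power_dominating_sets G. x ^ card S) +
    (\<Sum>S\<in>almost_power_dominating_sets H. x ^ card S) +
    ((x + 1) ^ card (pverts G) - 1) * ((x + 1) ^ card (pverts H) - 1)"
proof -
  interpret G: pair_graph G by fact
  interpret H: pair_graph H by fact
  let ?A = "Pow (pverts G) - {{}}" and ?B = "Pow (pverts H) - {{}}"
  let ?QG = "almost_power_dominating_sets G" and ?QH = "almost_power_dominating_sets H"
  let ?L = "(`) Inl ` ?QG :: ('a + 'b) set set" and ?R = "(`) Inr ` ?QH :: ('a + 'b) set set"
    and ?M = "(\<lambda>(A, B). A <+> B) ` (?A \<times> ?B)"
  have Q: "?QG \<subseteq> ?A" "?QH \<subseteq> ?B" by (auto simp: almost_power_dominating_sets_def)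
  have finQ: "finite ?QG" "finite ?QH"
    using Q by (meson G.pair_finite_verts H.pair_finite_verts finite_Diff finite_Pow_iff finite_subset)+
  have fin: "finite ?L" "finite ?R" "finite ?M"
    using finQ by (auto simp: G.pair_finite_verts H.pair_finite_verts)
  \<comment> \<open>A left and a right image can coincide only when empty, and almost power
    dominating sets are nonempty.\<close>
  have LR: "?L \<inter> ?R = {}"
  proof (rule ccontr)
    assume "?L \<inter> ?R \<noteq> {}"
    then obtain S where S: "S \<in> ?L" "S \<in> ?R" by blast
    from S(1) obtain A where A: "A \<in> ?QG" "S = Inl ` A" by (rule imageE)
    from S(2) obtain B where B: "S = Inr ` B" by (rule imageE)
    from A(1) Q(1) obtain a where "a \<in> A" by auto
    with A(2) B show False by (metis Inl_Inr_False image_iff)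
  qed
  have LRM: "(?L \<union> ?R) \<inter> ?M = {}"
  proof -
    have "S \<notin> ?M" if "S \<in> ?L \<union> ?R" for S
      using that by (auto simp: Plus_def)
    then show ?thesis by blast
  qed
  have L: "(\<Sum>S\<in>?L. x ^ card S) = (\<Sum>S\<in>?QG. x ^ card S)"
    by (subst sum.reindex) (auto simp: inj_on_def inj_image_eq_iff card_image)
  have R: "(\<Sum>S\<in>?R. x ^ card S) = (\<Sum>S\<in>?QH. x ^ card S)"
    by (subst sum.reindex) (auto simp: inj_on_def inj_image_eq_iff card_image)
  have inj: "inj_on (\<lambda>(A, B). A <+> B) (?A \<times> ?B)"
    by (rule inj_on_inverseI[where g = "\<lambda>S. (Inl -` S, Inr -` S)"]) auto
  have "(\<Sum>S\<in>?M. x ^ card S) = (\<Sum>(A, B)\<in>?A \<times> ?B. x ^ card A * x ^ card B)"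
    unfolding sum.reindex[OF inj] o_def
    by (rule sum.cong)
      (auto simp: card_Plus power_add
        dest!: finite_subset[OF _ G.pair_finite_verts] finite_subset[OF _ H.pair_finite_verts])
  also have "\<dots> = (\<Sum>A\<in>?A. x ^ card A) * (\<Sum>B\<in>?B. x ^ card B)"
    by (simp add: sum_product sum.cartesian_product)
  \<comment> \<open>Discarding the empty set from each power set accounts for the two subtractions
    of 1.\<close>
  also have "\<dots> = ((x + 1) ^ card (pverts G) - 1) * ((x + 1) ^ card (pverts H) - 1)"
    by (simp add: sum_diff sum_Pow_power_card G.pair_finite_verts H.pair_finite_verts)
  finally show ?thesis
    unfolding power_dominating_sets_join[OF assms]
    using fin LR LRM L R by (simp add: sum.union_disjoint)
qed

theorem theorem18:
  fixes G1 :: "'a pair_pre_digraph" and G2 :: "'b pair_pre_digraph"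
    and n1 n2 I1 I2 :: nat
    and x :: "int poly fract"
  assumes "pair_graph G1" and "pverts G1 \<noteq> {}"
    and "pair_graph G2" and "pverts G2 \<noteq> {}"
    and "n1 = card (pverts G1)" and "n2 = card (pverts G2)"
    and "I1 = (if n1 > 1 then card (isolated_verts G1) else 0)"
    and "I2 = (if n2 > 1 then card (isolated_verts G2) else 0)"
    and "x = to_fract [:0, 1:]"
  shows "to_fract (power_dom_poly (graph_join G1 G2)) =
           (1 + of_nat I1 / x) * to_fract (power_dom_poly G1)
         + (1 + of_nat I2 / x) * to_fract (power_dom_poly G2)
         + ((x + 1) ^ n1 - 1) * ((x + 1) ^ n2 - 1)"
proof -
  note weights = to_fract_power_dom_poly[folded assms(9)]
  have "x \<noteq> 0" using assms(9) by simp
  \<comment> \<open>The indeterminate is invertible in the fraction field, so the identities with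
    cleared denominator can be divided by \<open>x\<close>.\<close>
  then have factor: "(1 + of_nat I / x) * p = q" if "x * q = (x + of_nat I) * p" for I p q
    using that by (simp add: field_simps)
  have "(1 + of_nat I1 / x) * to_fract (power_dom_poly G1) =
      (\<Sum>S\<in>almost_power_dominating_sets G1. x ^ card S)"
    unfolding weights[OF assms(1,2)] assms(5,7)
    by (rule factor[OF sum_almost_power_dominating_sets[OF assms(1,2)]])
  moreover have "(1 + of_nat I2 / x) * to_fract (power_dom_poly G2) =
      (\<Sum>S\<in>almost_power_dominating_sets G2. x ^ card S)"
    unfolding weights[OF assms(3,4)] assms(6,8)
    by (rule factor[OF sum_almost_power_dominating_sets[OF assms(3,4)]])
  moreover have "pverts (graph_join G1 G2) \<noteq> {}"
    using assms(2) by (simp add: graph_join_def)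
  ultimately show ?thesis
    using sum_power_dominating_sets_join[OF assms(1-4), of x] assms(5,6)
    by (simp add: weights[OF pair_graph_graph_join[OF assms(1,3)]])
qed

end
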